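(* Let $p\ge1$, let $u\in F^1_{USC}(X)$ and for each positive integer $n$, let $u_n\in F^1_{USC}(X)$. If $d_p^*(u_n,u)\to0$, then $H_{\rm end}(u_n,u)\to0$.
   Context: $(X,d)$ is a nonempty metric space. $X\times[0,1]$ carries the metric $\overline d((x,\alpha),(y,\beta))=d(x,y)+|\alpha-\beta|$. A fuzzy set in $X$ is a function $u:X\to[0,1]$, with $\alpha$-cuts $[u]_\alpha=\{x\in X: u(x)\ge\alpha\}$ for $\alpha\in(0,1]$ and $[u]_0=\overline{\{x\in X:u(x)>0\}}$ (closure in $X$). $F^1_{USC}(X)$ is the set of fuzzy sets $u$ in $X$ such that $[u]_\alpha$ is nonempty and closed for all $\alpha\in[0,1]$. For nonempty closed sets $A,B$, $H(A,B)=\max\{\sup_{a\in A}\inf_{b\in B}\rho(a,b),\sup_{b\in B}\inf_{a\in A}\rho(a,b)\}\in[0,+\infty]$ is the Hausdorff distance, with $\rho=d$ on $X$ and $\rho=\overline d$ on $X\times[0,1]$. With ${\rm end}\,u=\{(x,t)\in X\times[0,1]:u(x)\ge t\}$, $H_{\rm end}(u,v)=H({\rm end}\,u,{\rm end}\,v)$. For $p\ge1$ and $u,v\in F^1_{USC}(X)$, $d_p^*(u,v)=\inf\{(\int_0^1 f(\alpha)^p\,d\alpha)^{1/p}: f\text{ is a (Lebesgue) measurable function from }[0,1]\text{ to }\mathbb R\cup\{+\infty\}\text{ with } f(\alpha)\ge H([u]_\alpha,[v]_\alpha)\text{ for }\alpha\in[0,1]\}$. *)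

theory Defs
  imports "HOL-Analysis.Analysis"
begin

definition fuzzy_set :: "('a \<Rightarrow> real) \<Rightarrow> bool" where
  "fuzzy_set u \<longleftrightarrow> (\<forall>x. 0 \<le> u x \<and> u x \<le> 1)"

text \<open>Meaningful for \<open>\<alpha>\<close> in the closed unit interval only.\<close>

definition cut :: "('a::metric_space \<Rightarrow> real) \<Rightarrow> real \<Rightarrow> 'a set" where
  "cut u \<alpha> = (if \<alpha> = 0 then closure {x. u x > 0} else {x. u x \<ge> \<alpha>})"

definition F1_USC :: "('a::metric_space \<Rightarrow> real) set" where
  "F1_USC = {u. fuzzy_set u \<and> (\<forall>\<alpha>\<in>{0..1}. cut u \<alpha> \<noteq> {} \<and> closed (cut u \<alpha>))}"

text \<open>The metric \<open>\<rho>\<close> is an explicit argument because the library's distance on product types is the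
  Euclidean combination of the two distances, not their sum. The value is in \<open>[0, \<infinity>]\<close>;
  the arguments are meant to be nonempty.\<close>

definition Hausdorff :: "('b \<Rightarrow> 'b \<Rightarrow> real) \<Rightarrow> 'b set \<Rightarrow> 'b set \<Rightarrow> ennreal" where
  "Hausdorff \<rho> A B =
     max (SUP a\<in>A. INF b\<in>B. ennreal (\<rho> a b)) (SUP b\<in>B. INF a\<in>A. ennreal (\<rho> a b))"

definition dist_bar :: "'a::metric_space \<times> real \<Rightarrow> 'a \<times> real \<Rightarrow> real" where
  "dist_bar z w = dist (fst z) (fst w) + \<bar>snd z - snd w\<bar>"

definition endograph :: "('a \<Rightarrow> real) \<Rightarrow> ('a \<times> real) set" where
  "endograph u = {(x, t). t \<in> {0..1} \<and> u x \<ge> t}"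

definition H_end :: "('a::metric_space \<Rightarrow> real) \<Rightarrow> ('a \<Rightarrow> real) \<Rightarrow> ennreal" where
  "H_end u v = Hausdorff dist_bar (endograph u) (endograph v)"

text \<open>Real powers on \<open>[0, \<infinity>]\<close>, for exponents \<open>r > 0\<close>.\<close>

definition ennreal_pow :: "ennreal \<Rightarrow> real \<Rightarrow> ennreal" where
  "ennreal_pow x r = (if x = \<infinity> then \<infinity> else ennreal (enn2real x powr r))"

text \<open>A function \<open>f\<close> into the reals extended by \<open>\<infinity>\<close> that dominates the Hausdorff distances of the cuts
  is nonnegative, so it is taken to be \<open>ennreal\<close>-valued.\<close>

definition d_star :: "real \<Rightarrow> ('a::metric_space \<Rightarrow> real) \<Rightarrow> ('a \<Rightarrow> real) \<Rightarrow> ennreal" where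
  "d_star p u v =
     Inf {ennreal_pow (\<integral>\<^sup>+ \<alpha>. ennreal_pow (f \<alpha>) p \<partial>lebesgue_on {0..1}) (1 / p) | f.
            f \<in> borel_measurable (lebesgue_on {0..1}) \<and>
            (\<forall>\<alpha>\<in>{0..1}. f \<alpha> \<ge> Hausdorff dist (cut u \<alpha>) (cut v \<alpha>))}"

end

theory Submission
  imports Defs
begin

text \<open>The theorem follows from the quantitative bound of \<open>H_end_le_of_d_star_less\<close>: if
  \<open>d\<^sub>p\<^sup>*(u, v) < \<epsilon>\<^bsup>1 + 1/p\<^esup>\<close>, then \<open>H\<^bsub>end\<^esub>(u, v) \<le> 2 \<epsilon>\<close>.

  This is a Chebyshev-type argument. A majorant \<open>f\<close> of the distances between the cuts whose
  \<open>p\<close>-norm is below \<open>\<epsilon>\<^bsup>1 + 1/p\<^esup>\<close> cannot be at least \<open>\<epsilon>\<close> throughout an interval of levels of length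
  \<open>\<epsilon>\<close>, because the integral of \<open>f\<^sup>p\<close> would then be at least \<open>\<epsilon>\<^bsup>p + 1\<^esup>\<close>. Hence every interval of levels of length \<open>\<epsilon>\<close> contains a level at
  which the cuts of \<open>u\<close> and \<open>v\<close> are \<open>\<epsilon>\<close>-close (\<open>d_star_less_imp_close_level\<close>).

  Such a level controls the endographs. A point \<open>(x, t)\<close> of one endograph with \<open>t \<le> \<epsilon>\<close> is
  \<open>\<epsilon>\<close>-close to \<open>(x, 0)\<close>, which lies in every endograph. If \<open>t > \<epsilon>\<close>, lower \<open>t\<close> by less than \<open>\<epsilon>\<close> to a
  level \<open>\<alpha>\<close> with \<open>\<epsilon>\<close>-close cuts; then \<open>x\<close> still lies in the cut at \<open>\<alpha>\<close>, and moving it by less than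
  \<open>\<epsilon>\<close> reaches the other cut (\<open>endograph_near_of_close_levels\<close>).\<close>

lemma ennreal_pow_ennreal:
  assumes "0 \<le> x"
  shows "ennreal_pow (ennreal x) r = ennreal (x powr r)"
  using assms by (simp add: ennreal_pow_def)

lemma ennreal_pow_mono:
  assumes "x \<le> y" "0 \<le> r"
  shows "ennreal_pow x r \<le> ennreal_pow y r"
proof (cases "y = \<infinity>")
  case False
  then have "x \<noteq> \<infinity>" using assms(1) by (auto simp: top_unique)
  moreover have "enn2real x \<le> enn2real y"
    using assms(1) False by (intro enn2real_mono) (auto simp: top.not_eq_extremum)
  ultimately show ?thesis
    using False assms(2) by (auto simp: ennreal_pow_def intro!: ennreal_leI powr_mono2)
qed (simp add: ennreal_pow_def)

lemma Hausdorff_commute: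
  assumes "\<And>x y. \<rho> x y = \<rho> y x"
  shows "Hausdorff \<rho> A B = Hausdorff \<rho> B A"
  unfolding Hausdorff_def by (subst (1 2) assms) (rule max.commute)

lemma Hausdorff_lessD:
  assumes "Hausdorff \<rho> A B < ennreal e" "a \<in> A"
  obtains b where "b \<in> B" "ennreal (\<rho> a b) < ennreal e"
proof -
  have "(INF b\<in>B. ennreal (\<rho> a b)) \<le> (SUP a\<in>A. INF b\<in>B. ennreal (\<rho> a b))"
    using assms(2) by (rule SUP_upper)
  also have "\<dots> < ennreal e"
    using assms(1) by (simp add: Hausdorff_def)
  finally show thesis using that by (auto simp: INF_less_iff)
qed

text \<open>Otherwise \<open>f\<^sup>p\<close> would be at least \<open>e\<^sup>p\<close> on an interval of length \<open>e\<close> for some admissible majorant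
  \<open>f\<close> with \<open>p\<close>-norm below \<open>e\<^bsup>1 + 1/p\<^esup>\<close>.\<close>

lemma d_star_less_imp_close_level:
  fixes u v :: "'a::metric_space \<Rightarrow> real"
  assumes "0 < p" "0 < e"
    and less: "d_star p u v < ennreal (e powr (1 + 1 / p))"
    and t: "e \<le> t" "t \<le> 1"
  shows "\<exists>\<alpha>. t - e < \<alpha> \<and> \<alpha> < t \<and> Hausdorff dist (cut u \<alpha>) (cut v \<alpha>) < ennreal e"
proof (rule ccontr)
  assume neg: "\<not> ?thesis"
  let ?M = "lebesgue_on {0..1::real}" and ?J = "{t - e<..<t}"
  obtain f where f: "\<And>\<alpha>. \<alpha> \<in> {0..1} \<Longrightarrow> Hausdorff dist (cut u \<alpha>) (cut v \<alpha>) \<le> f \<alpha>"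
    and f_less: "ennreal_pow (\<integral>\<^sup>+ \<alpha>. ennreal_pow (f \<alpha>) p \<partial>?M) (1 / p) < ennreal (e powr (1 + 1 / p))"
    using less unfolding d_star_def Inf_less_iff by blast
  have J: "?J \<subseteq> {0..1}" using t by auto
  have f_ge: "ennreal e \<le> f \<alpha>" if "\<alpha> \<in> ?J" for \<alpha>
  proof -
    have "ennreal e \<le> Hausdorff dist (cut u \<alpha>) (cut v \<alpha>)"
      using neg that by (meson greaterThanLessThan_iff not_less)
    then show ?thesis using f J that by (meson order_trans subsetD)
  qed
  have J_sets: "?J \<in> sets ?M"
    using J by (auto simp: sets_restrict_space_iff)
  have "emeasure ?M ?J = ennreal e"
    using J \<open>0 < e\<close> by (subst emeasure_restrict_space) auto
  then have "ennreal (e powr (p + 1)) = ennreal (e powr p) * emeasure ?M ?J"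
    using \<open>0 < e\<close> by (simp add: powr_add ennreal_mult)
  also have "\<dots> = (\<integral>\<^sup>+ \<alpha>. ennreal (e powr p) * indicator ?J \<alpha> \<partial>?M)"
    using J_sets by (simp add: nn_integral_cmult_indicator)
  also have "\<dots> \<le> (\<integral>\<^sup>+ \<alpha>. ennreal_pow (f \<alpha>) p \<partial>?M)"
  proof (rule nn_integral_mono)
    fix \<alpha>
    show "ennreal (e powr p) * indicator ?J \<alpha> \<le> ennreal_pow (f \<alpha>) p"
      using ennreal_pow_mono[OF f_ge, of \<alpha> p] \<open>0 < e\<close> \<open>0 < p\<close>
      by (auto simp: ennreal_pow_ennreal indicator_def)
  qed
  finally have "ennreal_pow (ennreal (e powr (p + 1))) (1 / p)
      \<le> ennreal_pow (\<integral>\<^sup>+ \<alpha>. ennreal_pow (f \<alpha>) p \<partial>?M) (1 / p)"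
    using \<open>0 < p\<close> by (intro ennreal_pow_mono) auto
  moreover have "ennreal_pow (ennreal (e powr (p + 1))) (1 / p) = ennreal (e powr (1 + 1 / p))"
    using \<open>0 < p\<close> by (simp add: ennreal_pow_ennreal powr_powr add_divide_distrib)
  ultimately show False using f_less by simp
qed

text \<open>Half of the Hausdorff distance; the other half is the same with \<open>u\<close> and \<open>v\<close> exchanged.\<close>

lemma endograph_near_of_close_levels:
  fixes u v :: "'a::metric_space \<Rightarrow> real"
  assumes "0 < e" "\<And>x. 0 \<le> v x"
    and levels: "\<And>t. e \<le> t \<Longrightarrow> t \<le> 1 \<Longrightarrow>
      \<exists>\<alpha>. t - e < \<alpha> \<and> \<alpha> < t \<and> Hausdorff dist (cut u \<alpha>) (cut v \<alpha>) < ennreal e"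
  shows "(SUP z\<in>endograph u. INF w\<in>endograph v. ennreal (dist_bar z w)) \<le> ennreal (2 * e)"
proof (rule SUP_least)
  fix z assume "z \<in> endograph u"
  then obtain x t where z: "z = (x, t)" and t: "0 \<le> t" "t \<le> 1" and ux: "t \<le> u x"
    by (auto simp: endograph_def)
  have "\<exists>w\<in>endograph v. dist_bar z w \<le> 2 * e"
  proof (cases "t \<le> e")
    case True
    have "(x, 0) \<in> endograph v" using assms(2) by (simp add: endograph_def)
    moreover have "dist_bar z (x, 0) \<le> 2 * e"
      using True t \<open>0 < e\<close> by (simp add: z dist_bar_def)
    ultimately show ?thesis by blast
  next
    case False
    then obtain \<alpha> where \<alpha>: "t - e < \<alpha>" "\<alpha> < t"
      and close: "Hausdorff dist (cut u \<alpha>) (cut v \<alpha>) < ennreal e"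
      using levels[of t] t by auto
    have "0 < \<alpha>" using False \<alpha> by simp
    then have "x \<in> cut u \<alpha>" using ux \<alpha> by (simp add: cut_def)
    then obtain y where y: "y \<in> cut v \<alpha>" "ennreal (dist x y) < ennreal e"
      by (rule Hausdorff_lessD[OF close])
    have "(y, \<alpha>) \<in> endograph v"
      using y(1) \<open>0 < \<alpha>\<close> \<alpha> t by (simp add: cut_def endograph_def)
    moreover have "dist_bar z (y, \<alpha>) \<le> 2 * e"
      using y(2) \<alpha> by (simp add: z dist_bar_def ennreal_less_iff)
    ultimately show ?thesis by blast
  qed
  then obtain w where w: "w \<in> endograph v" "dist_bar z w \<le> 2 * e" by blast
  then show "(INF w\<in>endograph v. ennreal (dist_bar z w)) \<le> ennreal (2 * e)"
    by (intro INF_lower2[OF w(1)] ennreal_leI)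
qed

lemma H_end_le_of_d_star_less:
  fixes u v :: "'a::metric_space \<Rightarrow> real"
  assumes "0 < p" "0 < e" "fuzzy_set u" "fuzzy_set v"
    and "d_star p u v < ennreal (e powr (1 + 1 / p))"
  shows "H_end u v \<le> ennreal (2 * e)"
proof -
  note levels = d_star_less_imp_close_level[OF assms(1,2,5)]
  have "(SUP z\<in>endograph u. INF w\<in>endograph v. ennreal (dist_bar z w)) \<le> ennreal (2 * e)"
    using assms(4) by (intro endograph_near_of_close_levels levels \<open>0 < e\<close>) (auto simp: fuzzy_set_def)
  moreover have "(SUP z\<in>endograph v. INF w\<in>endograph u. ennreal (dist_bar z w)) \<le> ennreal (2 * e)"
    using assms(3) levels
    by (intro endograph_near_of_close_levels \<open>0 < e\<close>)
      (auto simp: fuzzy_set_def Hausdorff_commute[of dist, OF dist_commute])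
  moreover have "dist_bar z w = dist_bar w z" for z w :: "'a \<times> real"
    by (simp add: dist_bar_def dist_commute abs_minus_commute)
  ultimately show ?thesis
    unfolding H_end_def Hausdorff_def by simp
qed

theorem theorem6p2:
  fixes p :: real
    and u :: "'a::metric_space \<Rightarrow> real"
    and u_seq :: "nat \<Rightarrow> 'a \<Rightarrow> real"
  assumes "p \<ge> 1"
    and "u \<in> F1_USC"
    and "\<And>n. n \<ge> 1 \<Longrightarrow> u_seq n \<in> F1_USC"
    and "(\<lambda>n. d_star p (u_seq n) u) \<longlonglongrightarrow> 0"
  shows "(\<lambda>n. H_end (u_seq n) u) \<longlonglongrightarrow> 0"
proof (rule order_tendstoI)
  fix a :: ennreal assume "0 < a"
  then obtain c where c: "0 < c" "c < a" using dense by blast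
  then have "c < top" by (meson less_le_trans top_greatest)
  then obtain r where r: "c = ennreal r" "0 < r"
    using c(1) by (cases c rule: ennreal_cases) (auto simp: ennreal_zero_less_top)
  define e where "e = r / 2"
  have "0 < e" and c_eq: "c = ennreal (2 * e)" using r by (simp_all add: e_def)
  have "0 < ennreal (e powr (1 + 1 / p))" using \<open>0 < e\<close> by simp
  then have "\<forall>\<^sub>F n in sequentially. d_star p (u_seq n) u < ennreal (e powr (1 + 1 / p))"
    using assms(4) by (simp add: order_tendstoD)
  then show "\<forall>\<^sub>F n in sequentially. H_end (u_seq n) u < a"
    using eventually_ge_at_top[of 1]
  proof eventually_elim
    case (elim n)
    then have "H_end (u_seq n) u \<le> ennreal (2 * e)"
      using assms(1,2) assms(3)[of n] \<open>0 < e\<close>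
      by (intro H_end_le_of_d_star_less[of p]) (auto simp: F1_USC_def)
    then show ?case using c(2) c_eq by simp
  qed
qed simp

end
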